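(* Let $X$ be a topological space, let $Y$ be a finite one-dimensional $T_0$ space, and let $f:X\longrightarrow X$ be a continuous function. Assume: (1) $\pi:X\longrightarrow Y$ is a continuous function. (2) For every closed point $y\in Y$, the set $\pi^{-1}(y)$ consists of exactly one point. (3) For every closed point $y\in Y$ and every open point $z\in U_y$, the unique point $x$ of $\pi^{-1}(y)$ belongs to $\overline{\pi^{-1}(z)}$. (4) $g:Y\longrightarrow P(Y)$ is the multifunction defined by $g(y)=\pi\bigl(f(\pi^{-1}(y))\bigr)$ for $y\in Y$. Then $g$ is lower semicontinuous at every point of $Y$.
   Context: For a point $y$ of a finite topological space $Y$, $U_y$ denotes the smallest open set containing $y$. A point $y$ is called open (closed) if $\{y\}$ is open (closed). $P(Y)$ is the collection of all subsets of $Y$. Dimension: $\dim Z=-1$ if and only if $Z=\emptyset$; for an integer $n\geq 0$, $\dim Z\leq n$ if $Z$ has a base $\beta$ such that $\dim\partial B\leq n-1$ for all $B\in\beta$, where the boundary $\partial B$ carries the subspace topology. "One-dimensional" means $\dim\leq 1$. A multifunction $F:Y\to P(Y)$ is lower semicontinuous at $y_0\in Y$ if for every open set $V$ in $Y$ with $F(y_0)\cap V\neq\emptyset$ there exists an open set $U$ containing $y_0$ such that $F(y)\cap V\neq\emptyset$ for each $y\in U$. *)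

theory Defs
  imports "HOL-Analysis.Analysis"
begin

text \<open>
  Dimension is the library relation \<open>X dim_le n\<close>, which is stated pointwise. The next two lemmas
  give the recursive characterisation by the empty space and by bases with low-dimensional
  boundaries.
\<close>

lemma dim_le_minus_one_iff: "X dim_le (- 1) \<longleftrightarrow> topspace X = {}"
proof
  assume "X dim_le (- 1)"
  then have *: "\<And>V a. openin X V \<Longrightarrow> a \<in> V \<Longrightarrow>
      \<exists>U. subtopology X (X frontier_of U) dim_le (- 2)"
    by (subst (asm) dimension_le.simps) fastforce
  show "topspace X = {}"
    using *[OF openin_topspace] dimension_le_bound by fastforce
next
  assume "topspace X = {}"
  then show "X dim_le (- 1)"
    by (subst dimension_le.simps) (use openin_subset in fastforce)
qed

lemma dim_le_iff_base:
  assumes "0 \<le> n"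
  shows "X dim_le n \<longleftrightarrow>
    (\<exists>\<B>. openin X = arbitrary union_of (\<lambda>B. B \<in> \<B>) \<and>
         (\<forall>B\<in>\<B>. subtopology X (X frontier_of B) dim_le (n - 1)))"
proof
  assume "X dim_le n"
  then have *: "\<And>V a. openin X V \<Longrightarrow> a \<in> V \<Longrightarrow>
      \<exists>U. a \<in> U \<and> U \<subseteq> V \<and> openin X U \<and> subtopology X (X frontier_of U) dim_le (n - 1)"
    by (subst (asm) dimension_le.simps) blast
  define \<B> where "\<B> = {U. openin X U \<and> subtopology X (X frontier_of U) dim_le (n - 1)}"
  have "openin X = arbitrary union_of (\<lambda>B. B \<in> \<B>)"
    unfolding openin_topology_base_unique \<B>_def using * by blast
  then show "\<exists>\<B>. openin X = arbitrary union_of (\<lambda>B. B \<in> \<B>) \<and>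
      (\<forall>B\<in>\<B>. subtopology X (X frontier_of B) dim_le (n - 1))"
    unfolding \<B>_def by blast
next
  assume "\<exists>\<B>. openin X = arbitrary union_of (\<lambda>B. B \<in> \<B>) \<and>
      (\<forall>B\<in>\<B>. subtopology X (X frontier_of B) dim_le (n - 1))"
  then obtain \<B> where "openin X = arbitrary union_of (\<lambda>B. B \<in> \<B>)"
    and low: "\<forall>B\<in>\<B>. subtopology X (X frontier_of B) dim_le (n - 1)" by blast
  then have "(\<forall>B\<in>\<B>. openin X B) \<and>
      (\<forall>U x. openin X U \<and> x \<in> U \<longrightarrow> (\<exists>B\<in>\<B>. x \<in> B \<and> B \<subseteq> U))"
    unfolding openin_topology_base_unique by blast
  with low assms show "X dim_le n"
    by (subst dimension_le.simps) (simp, blast)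
qed

text \<open>
  The smallest open set containing \<open>y\<close>, as the intersection of all of them. It is itself open
  only under a hypothesis such as finiteness of the space.
\<close>

definition min_open :: "'a topology \<Rightarrow> 'a \<Rightarrow> 'a set" where
  "min_open Y y = \<Inter>{U. openin Y U \<and> y \<in> U}"

lemma min_open_least:
  assumes "finite (topspace Y)" "y \<in> topspace Y"
  shows "openin Y (min_open Y y)" "y \<in> min_open Y y"
    and "\<And>U. openin Y U \<Longrightarrow> y \<in> U \<Longrightarrow> min_open Y y \<subseteq> U"
proof -
  have "{U. openin Y U \<and> y \<in> U} \<subseteq> Pow (topspace Y)"
    using openin_subset by blast
  then have "finite {U. openin Y U \<and> y \<in> U}"
    using assms(1) finite_subset by blast
  moreover have "{U. openin Y U \<and> y \<in> U} \<noteq> {}"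
    using assms(2) by blast
  ultimately show "openin Y (min_open Y y)"
    unfolding min_open_def by (intro openin_Inter) auto
qed (auto simp: min_open_def)

definition lower_semicontinuous_at :: "'a topology \<Rightarrow> ('a \<Rightarrow> 'a set) \<Rightarrow> 'a \<Rightarrow> bool" where
  "lower_semicontinuous_at Y F y\<^sub>0 \<longleftrightarrow>
     (\<forall>V. openin Y V \<and> F y\<^sub>0 \<inter> V \<noteq> {} \<longrightarrow>
        (\<exists>U. openin Y U \<and> y\<^sub>0 \<in> U \<and> (\<forall>y\<in>U. F y \<inter> V \<noteq> {})))"

end

theory Submission
  imports Defs
begin

text \<open>
  Specialisation chains in a finite \<open>T\<^sub>0\<close> space of dimension at most one have at most two
  points, so every point is open or closed. At an open point lower semicontinuity is trivial. At a
  closed point \<open>y\<close> the minimal neighbourhood contains besides \<open>y\<close> only open points \<open>z\<close>. If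
  \<open>x\<close> is the point over \<open>y\<close> and \<open>\<pi> (f x) \<in> V\<close>, then the open set of all \<open>x'\<close> with
  \<open>\<pi> (f x') \<in> V\<close> contains \<open>x\<close>, which is in the closure of the fibre over \<open>z\<close>, hence this set
  meets that fibre.
\<close>

text \<open>\<open>x \<in> min_open Y y\<close> is the specialisation preorder; the T0 axiom makes
  it antisymmetric.\<close>

lemma min_open_antisym:
  assumes "t0_space Y" "x \<in> topspace Y" "y \<in> topspace Y"
    and "x \<in> min_open Y y" "y \<in> min_open Y x"
  shows "x = y"
proof (rule ccontr)
  assume "x \<noteq> y"
  then obtain U where "openin Y U" "x \<notin> U \<longleftrightarrow> y \<in> U"
    using assms(1-3) unfolding t0_space_def by blast
  then show False
    using assms(4,5) unfolding min_open_def by blast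
qed

lemma in_closure_of_if_min_open:
  assumes "y \<in> topspace Y" "z \<in> min_open Y y" "z \<in> S"
  shows "y \<in> Y closure_of S"
  using assms unfolding in_closure_of min_open_def by blast

lemma min_open_eq_singleton_imp_openin:
  assumes "finite (topspace Y)" "y \<in> topspace Y" "min_open Y y \<subseteq> {y}"
  shows "openin Y {y}"
  using assms min_open_least(1,2)[OF assms(1,2)] by (metis subset_singletonD empty_iff)

text \<open>The closure of \<open>{y}\<close> has a further point \<open>c\<close>, and every open
  set around \<open>c\<close> meets \<open>{y}\<close>.\<close>

lemma not_closedin_singleton_obtains:
  assumes "y \<in> topspace Y" "\<not> closedin Y {y}"
  obtains c where "c \<in> topspace Y" "c \<noteq> y" "y \<in> min_open Y c"
proof -
  have "\<not> Y closure_of {y} \<subseteq> {y}"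
    using assms closure_of_subset_eq by fastforce
  then obtain c where "c \<in> Y closure_of {y}" "c \<noteq> y"
    by blast
  then have "c \<in> topspace Y" "y \<in> min_open Y c"
    by (auto simp: in_closure_of min_open_def)
  with \<open>c \<noteq> y\<close> show thesis
    using that by blast
qed

text \<open>Otherwise \<open>y\<close> is the middle of a three-point chain \<open>z\<close>,
  \<open>y\<close>, \<open>c\<close>. Then \<open>y\<close> and \<open>c\<close> both lie on the
  boundary of a small neighbourhood of \<open>z\<close>. That boundary has dimension at most 0, so a
  clopen set would separate them, although \<open>y\<close> is in every open set around
  \<open>c\<close>.\<close>

lemma openin_or_closedin_singleton:
  assumes fin: "finite (topspace Y)" and t0: "t0_space Y" and dim: "Y dim_le 1"
    and y: "y \<in> topspace Y"
  shows "openin Y {y} \<or> closedin Y {y}"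
proof (rule ccontr)
  assume neg: "\<not> (openin Y {y} \<or> closedin Y {y})"
  obtain c where c: "c \<in> topspace Y" "c \<noteq> y" "y \<in> min_open Y c"
    using not_closedin_singleton_obtains y neg by metis
  obtain z where z: "z \<in> min_open Y y" "z \<noteq> y"
    using min_open_eq_singleton_imp_openin[OF fin y] neg by blast
  note Uy = min_open_least[OF fin y]
  have zY: "z \<in> topspace Y"
    using z Uy(1) openin_subset by blast
  note Uz = min_open_least[OF fin zY]
  have y_notin: "y \<notin> min_open Y z"
    using min_open_antisym[OF t0 zY y z(1)] z(2) by blast
  have "\<And>V a. openin Y V \<Longrightarrow> a \<in> V \<Longrightarrow>
      \<exists>U. a \<in> U \<and> U \<subseteq> V \<and> openin Y U \<and> subtopology Y (Y frontier_of U) dim_le 0"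
    using dim by (subst (asm) dimension_le.simps) simp
  then obtain B where B: "z \<in> B" "B \<subseteq> min_open Y z" "openin Y B"
    and dimB: "subtopology Y (Y frontier_of B) dim_le 0"
    using Uz(1,2) by meson
  \<comment> \<open>An open set containing \<open>c\<close> contains \<open>y\<close>, but
    \<open>B\<close> lies inside \<open>min_open Y z\<close>, which misses \<open>y\<close>.\<close>
  have c_notin: "c \<notin> B"
    using c(3) B(2,3) y_notin unfolding min_open_def by blast
  have zc: "z \<in> min_open Y c"
    using z(1) c(3) unfolding min_open_def by blast
  have front: "y \<in> Y frontier_of B" "c \<in> Y frontier_of B"
    using in_closure_of_if_min_open[OF y z(1) B(1)] in_closure_of_if_min_open[OF c(1) zc B(1)]
      y_notin c_notin B(2,3) by (auto simp: frontier_of_def interior_of_openin)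
  let ?F = "subtopology Y (Y frontier_of B)"
  have "openin ?F (Y frontier_of B \<inter> min_open Y y)"
    using Uy(1) by (rule openin_subtopology_Int2)
  moreover have "y \<in> Y frontier_of B \<inter> min_open Y y"
    using front(1) Uy(2) by blast
  moreover have "neighbourhood_base_of (\<lambda>K. closedin ?F K \<and> openin ?F K) ?F"
    using dimB dimension_le_0_neighbourhood_base_of_clopen by blast
  \<comment> \<open>Only the closed side of the clopen \<open>K\<close> matters: it must contain
    \<open>c\<close> along with \<open>y\<close>, yet it stays inside
    \<open>min_open Y y\<close>.\<close>
  ultimately obtain K where K: "closedin ?F K" "y \<in> K" "K \<subseteq> min_open Y y"
    unfolding neighbourhood_base_of by (meson IntE subset_iff)
  obtain C where C: "closedin Y C" "K = C \<inter> Y frontier_of B"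
    using K(1) unfolding closedin_subtopology by blast
  have "c \<in> C"
  proof (rule ccontr)
    assume "c \<notin> C"
    then have "min_open Y c \<subseteq> topspace Y - C"
      using min_open_least(3)[OF fin c(1)] C(1) c(1) by blast
    then show False
      using c(3) K(2) C(2) by blast
  qed
  then have "c \<in> min_open Y y"
    using C(2) front(2) K(3) by blast
  then show False
    using min_open_antisym[OF t0 c(1) y] c(2,3) by blast
qed

text \<open>If \<open>z\<close> were closed, removing it from the space would leave an open set
  around \<open>y\<close> without \<open>z\<close>.\<close>

lemma openin_singleton_in_min_open:
  assumes "finite (topspace Y)" "t0_space Y" "Y dim_le 1"
    and y: "y \<in> topspace Y" and z: "z \<in> min_open Y y" "z \<noteq> y"
  shows "openin Y {z}"
proof -
  have "z \<in> topspace Y"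
    using z(1) min_open_least(1)[OF assms(1) y] openin_subset by blast
  moreover have "\<not> closedin Y {z}"
  proof
    assume "closedin Y {z}"
    then have "min_open Y y \<subseteq> topspace Y - {z}"
      using min_open_least(3)[OF assms(1) y] y z(2) by blast
    then show False
      using z(1) by blast
  qed
  ultimately show ?thesis
    using openin_or_closedin_singleton[OF assms(1-3)] by blast
qed

theorem theorem7p12:
  fixes X :: "'a topology" and Y :: "'b topology"
    and f :: "'a \<Rightarrow> 'a" and \<pi> :: "'a \<Rightarrow> 'b" and g :: "'b \<Rightarrow> 'b set"
  assumes "finite (topspace Y)" and "t0_space Y" and "Y dim_le 1"
    and "continuous_map X X f"
    and "continuous_map X Y \<pi>"
    and "\<And>y. y \<in> topspace Y \<Longrightarrow> closedin Y {y} \<Longrightarrow>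
           \<exists>!x. x \<in> {x \<in> topspace X. \<pi> x = y}"
    and "\<And>y z x. y \<in> topspace Y \<Longrightarrow> closedin Y {y} \<Longrightarrow> openin Y {z} \<Longrightarrow> z \<in> min_open Y y \<Longrightarrow>
           x \<in> {x \<in> topspace X. \<pi> x = y} \<Longrightarrow>
           x \<in> X closure_of {x \<in> topspace X. \<pi> x = z}"
    and "\<And>y. y \<in> topspace Y \<Longrightarrow> g y = \<pi> ` (f ` {x \<in> topspace X. \<pi> x = y})"
  shows "\<forall>y \<in> topspace Y. lower_semicontinuous_at Y g y"
proof
  fix y assume y: "y \<in> topspace Y"
  show "lower_semicontinuous_at Y g y"
    unfolding lower_semicontinuous_at_def
  proof (intro allI impI)
    fix V assume V: "openin Y V \<and> g y \<inter> V \<noteq> {}"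
    show "\<exists>U. openin Y U \<and> y \<in> U \<and> (\<forall>y\<in>U. g y \<inter> V \<noteq> {})"
    proof (cases "openin Y {y}")
      case True
      with V show ?thesis by blast
    next
      case False
      then have closed: "closedin Y {y}"
        using openin_or_closedin_singleton[OF assms(1-3) y] by blast
      obtain x where x: "x \<in> topspace X" "\<pi> x = y" "\<pi> (f x) \<in> V"
        using V assms(8)[OF y] by auto
      define W where "W = {x \<in> topspace X. (\<pi> \<circ> f) x \<in> V}"
      have W: "openin X W" "x \<in> W"
        using openin_continuous_map_preimage[OF continuous_map_compose[OF assms(4,5)]] V x
        by (auto simp: W_def)
      \<comment> \<open>The witness for semicontinuity is \<open>min_open Y y\<close>, which is open
        because \<open>Y\<close> is finite.\<close>
      have "g z \<inter> V \<noteq> {}" if z: "z \<in> min_open Y y" for z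
      proof (cases "z = y")
        case True
        with V show ?thesis by blast
      next
        case False
        then have oz: "openin Y {z}"
          using openin_singleton_in_min_open[OF assms(1-3) y z] by blast
        then have "x \<in> X closure_of {x \<in> topspace X. \<pi> x = z}"
          using assms(7)[OF y closed _ z] x by blast
        then obtain x' where "x' \<in> W" "\<pi> x' = z"
          using W unfolding in_closure_of by blast
        moreover have "z \<in> topspace Y"
          using oz openin_subset by blast
        ultimately show ?thesis
          using assms(8)[of z] by (auto simp: W_def)
      qed
      then show ?thesis
        using min_open_least(1,2)[OF assms(1) y] by blast
    qed
  qed
qed

end
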